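(* For $(\alpha,\beta,\gamma)\in\mathbb{R}^3$ let $f(t)=t^4+\alpha t^3+\beta t^2+\gamma t+1$ and $$\Delta(f)=4[\beta^2-3\alpha\gamma+12]^3-[72\beta+9\alpha\beta\gamma-2\beta^3-27\alpha^2-27\gamma^2]^2.$$ Let $$S=\{(\alpha,\beta,\gamma): f(t)>0\text{ for all }t\},\qquad \bar S=\{(\alpha,\beta,\gamma): f(t)\ge 0\text{ for all }t\},$$ where $t$ ranges over the reals. Then: (1) $\bar S$ is a closed convex cone with a recession direction $(0,1,0)$ and an apex $(0,-2,0)$. (2) $\bar S$ is symmetric with respect to $\alpha$ and $\gamma$, i.e., if $(\alpha,\beta,\gamma)\in\bar S$, then $(\gamma,\beta,\alpha)\in\bar S$ and $(-\alpha,\beta,-\gamma)\in\bar S$. (3) For any $(\alpha,\beta,\gamma)$ in the interior of $\bar S$: if $2\le\beta<6$, $\alpha=\gamma$ and $\alpha^2+8=4\beta$, then $\Delta(f)=0$; otherwise $\Delta(f)>0$. (4) For any $(\alpha,\beta,\gamma)$ at the boundary of $\bar S$, $\Delta(f)=0$. (5) The set $S$ is the interior of $\bar S$.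
   Context: All coefficients are real; interior and boundary are taken in $\mathbb{R}^3$. $\Delta(f)$, defined by the displayed formula, is (up to a positive constant factor) the discriminant of $f$. A recession direction of a convex set $C$ is a vector $w$ such that $x+\delta w\in C$ for all $x\in C$ and $\delta>0$.
   Formalization: "Cone with apex (0,-2,0)" is false for dilations: (4,6,4) is in the set, but its dilate by 2 about the apex, (8,14,8), has f(-2)=-7. What is proved: a closed convex set with recession direction (0,1,0), with (0,-2,0) its unique point of smallest β. *)

theory Defs
  imports "HOL-Analysis.Analysis"
begin

definition quartic :: "real \<Rightarrow> real \<Rightarrow> real \<Rightarrow> real \<Rightarrow> real" where
  "quartic \<alpha> \<beta> \<gamma> t = t^4 + \<alpha> * t^3 + \<beta> * t^2 + \<gamma> * t + 1"

definition Disc :: "real \<Rightarrow> real \<Rightarrow> real \<Rightarrow> real" where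
  "Disc \<alpha> \<beta> \<gamma> =
     4 * (\<beta>^2 - 3 * \<alpha> * \<gamma> + 12)^3
     - (72 * \<beta> + 9 * \<alpha> * \<beta> * \<gamma> - 2 * \<beta>^3 - 27 * \<alpha>^2 - 27 * \<gamma>^2)^2"

definition S :: "(real \<times> real \<times> real) set" where
  "S = {(\<alpha>, \<beta>, \<gamma>). \<forall>t. quartic \<alpha> \<beta> \<gamma> t > 0}"

(* Defined by the nonstrict inequality, not as the topological closure of S. *)
definition Sbar :: "(real \<times> real \<times> real) set" where
  "Sbar = {(\<alpha>, \<beta>, \<gamma>). \<forall>t. quartic \<alpha> \<beta> \<gamma> t \<ge> 0}"

definition recession_direction :: "'a::real_vector set \<Rightarrow> 'a \<Rightarrow> bool" where
  "recession_direction C w \<longleftrightarrow> (\<forall>x\<in>C. \<forall>\<delta>>0. x + \<delta> *\<^sub>R w \<in> C)"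

(* Sbar is not a cone in the sense of invariance under dilations centred at
   its apex (Sbar_not_dilation_cone below).  "Closed convex cone with recession direction w and
   apex v" is therefore read as: a closed convex set with recession direction w whose tip is v,
   that is, v is its only lowest point when height is measured along w. *)
definition apex :: "'a::real_inner set \<Rightarrow> 'a \<Rightarrow> 'a \<Rightarrow> bool" where
  "apex C w v \<longleftrightarrow> v \<in> C \<and> (\<forall>x\<in>C. x \<noteq> v \<longrightarrow> v \<bullet> w < x \<bullet> w)"

(* The point (4, 6, 4), i.e. (t + 1)^4, lies in Sbar, but its dilate (8, 14, 8) by the factor 2
   about (0, -2, 0) does not. *)
lemma Sbar_not_dilation_cone: "\<not> cone ((\<lambda>x. x - (0, -2, 0)) ` Sbar)"
proof
  assume c: "cone ((\<lambda>x. x - (0, -2, 0)) ` Sbar)"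
  have "quartic 4 6 4 t = (t + 1)^4" for t
    by (simp add: quartic_def power4_eq_xxxx power3_eq_cube power2_eq_square algebra_simps)
  then have "(4, 6, 4) \<in> Sbar"
    by (simp add: Sbar_def)
  then have "(4, 8, 4) \<in> (\<lambda>x. x - (0, -2, 0)) ` Sbar"
    by (force simp: image_iff)
  with c have "2 *\<^sub>R (4, 8, 4) \<in> (\<lambda>x. x - (0, -2, 0)) ` Sbar"
    unfolding cone_def by (metis zero_le_numeral)
  then have "(8, 14, 8) \<in> Sbar"
    by (auto simp: image_iff)
  then have "quartic 8 14 8 (-2) \<ge> 0"
    by (simp add: Sbar_def)
  then show False
    by (simp add: quartic_def)
qed

end

theory Submission
  imports Defs "HOL-Computational_Algebra.Fundamental_Theorem_Algebra"
begin

text \<open>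
  A quartic with a double real root \<open>r\<close> factors as \<open>(t - r)\<^sup>2\<close> times a real quadratic, and a positive
  quartic factors as two real quadratics without real roots. On a product of two quadratics \<open>Disc\<close> is
  27 times the product of the two quadratic discriminants and the square of the resultant, which
  settles its sign; for a positive quartic it vanishes only if the two factors coincide, in which case
  the quartic is the square of \<open>t\<^sup>2 + (\<alpha>/2) t + 1\<close>. Moreover a product of two positive quadratics is
  bounded below by a positive multiple of \<open>(1 + t\<^sup>2)\<^sup>2\<close>, so positivity survives small perturbations
  of the coefficients; conversely, at a zero, which is never at \<open>t = 0\<close>, lowering \<open>\<beta>\<close> makes the quartic
  negative.
\<close>

subsection \<open>Quadratic factors and the discriminant\<close>

lemma quartic_0 [simp]: "quartic \<alpha> \<beta> \<gamma> 0 = 1"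
  by (simp add: quartic_def)

text \<open>The resultant of \<open>t^2 + p * t + q\<close> and
  \<open>t^2 + u * t + v\<close>.\<close>

definition resultant2 :: "real \<Rightarrow> real \<Rightarrow> real \<Rightarrow> real \<Rightarrow> real" where
  "resultant2 p q u v = (q - v)^2 + (p - u) * (p * v - q * u)"

text \<open>The identity holds for all quadratics only after the constant term \<open>1\<close> has been replaced by
  \<open>q * v\<close>; hence the hypothesis.\<close>
lemma Disc_product:
  assumes "q * v = 1"
  shows "Disc (p + u) (q + v + p * u) (p * v + q * u)
           = 27 * (p^2 - 4 * q) * (u^2 - 4 * v) * (resultant2 p q u v)^2"
proof -
  have "4 * ((q + v + p * u)^2 - 3 * (p + u) * (p * v + q * u) + 12 * (q * v))^3
     - (72 * (q + v + p * u) * (q * v) + 9 * (p + u) * (q + v + p * u) * (p * v + q * u)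
        - 2 * (q + v + p * u)^3 - 27 * (p + u)^2 * (q * v) - 27 * (p * v + q * u)^2)^2
     = 27 * (p^2 - 4 * q) * (u^2 - 4 * v) * (resultant2 p q u v)^2"
    unfolding resultant2_def by algebra
  then show ?thesis
    by (simp add: Disc_def assms)
qed

lemma quartic_product:
  assumes "q * v = 1"
  shows "quartic (p + u) (q + v + p * u) (p * v + q * u) t = (t^2 + p * t + q) * (t^2 + u * t + v)"
  unfolding quartic_def using assms by algebra

text \<open>A zero of a nonnegative polynomial is a minimum, so the derivative vanishes there as
  well. The equations are shaped to match \<open>Disc_product\<close> with
  \<open>p = - 2 * r\<close> and \<open>q = r^2\<close>.\<close>

lemma double_root_factor:
  assumes "quartic \<alpha> \<beta> \<gamma> r = 0" and "\<And>t. quartic \<alpha> \<beta> \<gamma> t \<ge> 0"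
  obtains u v where "r^2 * v = 1" "\<alpha> = - 2 * r + u" "\<beta> = r^2 + v + (- 2 * r) * u"
    "\<gamma> = (- 2 * r) * v + r^2 * u"
proof -
  have "(quartic \<alpha> \<beta> \<gamma> has_real_derivative 4 * r^3 + 3 * \<alpha> * r^2 + 2 * \<beta> * r + \<gamma>) (at r)"
    unfolding quartic_def by (auto intro!: derivative_eq_intros)
  then have "4 * r^3 + 3 * \<alpha> * r^2 + 2 * \<beta> * r + \<gamma> = 0"
    by (rule DERIV_local_min[of _ _ _ 1]) (use assms in auto)
  moreover have "r^4 + \<alpha> * r^3 + \<beta> * r^2 + \<gamma> * r + 1 = 0"
    using assms(1) by (simp add: quartic_def)
  ultimately have "r^2 * (\<beta> + 2 * r * (\<alpha> + 2 * r) - r^2) = 1"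
    "\<gamma> = (- 2 * r) * (\<beta> + 2 * r * (\<alpha> + 2 * r) - r^2) + r^2 * (\<alpha> + 2 * r)"
    by algebra+
  then show ?thesis
    by (intro that[of "\<beta> + 2 * r * (\<alpha> + 2 * r) - r^2" "\<alpha> + 2 * r"]) auto
qed

text \<open>A complex zero \<open>z\<close> cannot be real, so \<open>z\<close> and its conjugate
  are the roots of a real quadratic, which divides the quartic.\<close>

lemma positive_factor:
  assumes pos: "\<And>t. quartic \<alpha> \<beta> \<gamma> t > 0"
  obtains p q u v where "q * v = 1" "\<alpha> = p + u" "\<beta> = q + v + p * u" "\<gamma> = p * v + q * u"
    "p^2 < 4 * q" "u^2 < 4 * v"
proof -
  define P :: "complex poly" where
    "P = [:1, of_real \<gamma>, of_real \<beta>, of_real \<alpha>, 1:]"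
  have "\<not> constant (poly P)"
    by (simp add: constant_degree P_def)
  then obtain z where "poly P z = 0"
    using fundamental_theorem_of_algebra by blast
  then have z: "z^4 + of_real \<alpha> * z^3 + of_real \<beta> * z^2 + of_real \<gamma> * z + 1 = 0"
    by (simp add: P_def algebra_simps power4_eq_xxxx power3_eq_cube power2_eq_square)
  define x y where "x = Re z" and "y = Im z"
  have y: "y \<noteq> 0"
  proof
    assume "y = 0"
    then have "z = of_real x"
      by (simp add: complex_eq_iff x_def y_def)
    with z have "of_real (quartic \<alpha> \<beta> \<gamma> x) = (0::complex)"
      by (simp add: quartic_def)
    with pos[of x] show False
      by (metis less_irrefl of_real_eq_0_iff)
  qed
  define p q where "p = - 2 * x" and "q = x^2 + y^2"
  \<comment> \<open>Division by \<open>t^2 + p * t + q\<close>: the quotient is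
    \<open>t^2 + u * t + v\<close>, the remainder \<open>m * t + n\<close>.\<close>
  define u where "u = \<alpha> - p"
  define v where "v = \<beta> - q - p * u"
  define m n where "m = \<gamma> - p * v - q * u" and "n = 1 - q * v"
  have quad: "z^2 + of_real p * z + of_real q = 0"
    by (simp add: complex_eq_iff p_def q_def x_def y_def power2_eq_square)
  have "z^4 + of_real \<alpha> * z^3 + of_real \<beta> * z^2 + of_real \<gamma> * z + 1
      = (z^2 + of_real p * z + of_real q) * (z^2 + of_real u * z + of_real v)
        + of_real m * z + of_real n"
    unfolding m_def n_def v_def u_def
    by (simp add: algebra_simps power4_eq_xxxx power3_eq_cube power2_eq_square)
  with z quad have "of_real m * z + of_real n = 0"
    by simp
  then have "m * y = 0" "m * x + n = 0"
    by (simp_all add: complex_eq_iff x_def y_def)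
  with y have "m = 0" "n = 0"
    by auto
  then have qv: "q * v = 1" and cf: "\<alpha> = p + u" "\<beta> = q + v + p * u" "\<gamma> = p * v + q * u"
    by (simp_all add: m_def n_def u_def v_def)
  have p: "p^2 < 4 * q"
    using y by (simp add: p_def q_def power_mult_distrib)
  have "(t^2 + p * t + q) * (t^2 + u * t + v) > 0" for t
    using pos[of t] by (simp add: cf quartic_product qv)
  \<comment> \<open>\<open>- u / 2\<close> minimizes the second factor, with value
    \<open>v - u^2 / 4\<close>; both the product and the first factor are positive there.\<close>
  moreover have "(- u / 2)^2 + p * (- u / 2) + q > 0"
  proof -
    have "(- u / 2)^2 + p * (- u / 2) + q = (p / 2 - u / 2)^2 + (4 * q - p^2) / 4"
      by (simp add: power2_eq_square field_simps)
    also have "\<dots> > 0"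
      using p by (intro add_nonneg_pos) auto
    finally show ?thesis .
  qed
  ultimately have "(- u / 2)^2 + u * (- u / 2) + v > 0"
    using zero_less_mult_pos by blast
  then have "u^2 < 4 * v"
    by (simp add: power2_eq_square field_simps)
  with p qv cf show ?thesis
    by (intro that)
qed

text \<open>Four times the resultant is a sum of two nonnegative terms; if both vanish, the second
  forces \<open>p = u\<close> and then the first forces \<open>q = v\<close>.\<close>

lemma resultant2_nonzero:
  assumes "p^2 < 4 * q" "(p, q) \<noteq> (u, v)"
  shows "resultant2 p q u v \<noteq> 0"
proof
  assume R: "resultant2 p q u v = 0"
  have "4 * resultant2 p q u v = (2 * (q - v) - p * (p - u))^2 + (4 * q - p^2) * (p - u)^2"
    unfolding resultant2_def by algebra
  with R have "(2 * (q - v) - p * (p - u))^2 + (4 * q - p^2) * (p - u)^2 = 0"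
    by simp
  moreover have "(4 * q - p^2) * (p - u)^2 \<ge> 0"
    using assms by simp
  ultimately have "(2 * (q - v) - p * (p - u))^2 = 0" "(4 * q - p^2) * (p - u)^2 = 0"
    by (smt (verit) zero_le_power2)+
  with assms show False
    by auto
qed

lemma Disc_square:
  assumes "\<alpha>^2 + 8 = 4 * \<beta>"
  shows "Disc \<alpha> \<beta> \<alpha> = 0"
proof -
  have "\<beta> = 1 + 1 + \<alpha> / 2 * (\<alpha> / 2)"
    using assms by (simp add: power2_eq_square)
  then show ?thesis
    using Disc_product[of 1 1 "\<alpha> / 2" "\<alpha> / 2"] by (simp add: resultant2_def)
qed

lemma Disc_pos:
  assumes pos: "\<And>t. quartic \<alpha> \<beta> \<gamma> t > 0"
    and nsq: "\<not> (2 \<le> \<beta> \<and> \<beta> < 6 \<and> \<alpha> = \<gamma> \<and> \<alpha>^2 + 8 = 4 * \<beta>)"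
  shows "Disc \<alpha> \<beta> \<gamma> > 0"
proof -
  obtain p q u v where qv: "q * v = 1"
    and cf: "\<alpha> = p + u" "\<beta> = q + v + p * u" "\<gamma> = p * v + q * u"
    and d: "p^2 < 4 * q" "u^2 < 4 * v"
    using positive_factor[OF pos] by metis
  have "(p, q) \<noteq> (u, v)"
  proof
    assume eq: "(p, q) = (u, v)"
    have "q > 0"
      using d(1) zero_le_power2[of p] by linarith
    moreover have "q^2 = 1"
      using eq qv by (simp add: power2_eq_square)
    ultimately have "q = 1"
      by (simp add: power2_eq_1_iff)
    \<comment> \<open>Now \<open>q = v = 1\<close> and \<open>u = p\<close>, so \<alpha> = \<gamma>
      = 2p and \<beta> = 2 + p^2 with p^2 < 4: exactly the excluded case.\<close>
    then show False
      using nsq d eq by (auto simp: cf power2_eq_square)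
  qed
  then have "(resultant2 p q u v)^2 > 0"
    using resultant2_nonzero[OF d(1)] by simp
  moreover have "(p^2 - 4 * q) * (u^2 - 4 * v) > 0"
    using d by (intro mult_neg_neg) auto
  ultimately have "27 * ((p^2 - 4 * q) * (u^2 - 4 * v)) * (resultant2 p q u v)^2 > 0"
    by (intro mult_pos_pos[OF mult_pos_pos]) simp
  then show ?thesis
    by (simp only: cf Disc_product[OF qv] mult.assoc)
qed

text \<open>The factor (t - r)^2 has discriminant zero, which kills the product formula.\<close>

lemma Disc_eq_0_if_root:
  assumes "quartic \<alpha> \<beta> \<gamma> r = 0" and "\<And>t. quartic \<alpha> \<beta> \<gamma> t \<ge> 0"
  shows "Disc \<alpha> \<beta> \<gamma> = 0"
proof -
  obtain u v where "r^2 * v = 1" "\<alpha> = - 2 * r + u" "\<beta> = r^2 + v + (- 2 * r) * u"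
    "\<gamma> = (- 2 * r) * v + r^2 * u"
    using double_root_factor[OF assms] by metis
  then show ?thesis
    using Disc_product[of "r^2" v "- 2 * r" u] by simp
qed

subsection \<open>Interior\<close>

text \<open>The constant makes the discriminant of the difference nonpositive.\<close>
lemma quadratic_lower_bound:
  fixes p q :: real
  assumes "p^2 < 4 * q"
  shows "(4 * q - p^2) / (4 * (1 + q)) * (1 + t^2) \<le> t^2 + p * t + q"
proof -
  define c where "c = (4 * q - p^2) / (4 * (1 + q))"
  have q: "q > 0"
    using assms zero_le_power2[of p] by linarith
  then have c1: "c < 1"
    by (simp add: c_def divide_simps add_pos_nonneg) (smt (verit) zero_le_power2)
  have "4 * (c * (1 + q)) = 4 * q - p^2"
    using q by (simp add: c_def field_simps)
  \<comment> \<open>Completing the square leaves \<open>4 * (1 - c) * (q - c) - p^2\<close>, which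
    equals \<open>4 * c^2\<close> by the choice of \<open>c\<close>.\<close>
  then have "4 * (1 - c) * (t^2 + p * t + q - c * (1 + t^2)) = (2 * (1 - c) * t + p)^2 + 4 * c^2"
    by algebra
  moreover have "(2 * (1 - c) * t + p)^2 + 4 * c^2 \<ge> 0"
    by (intro add_nonneg_nonneg) simp_all
  ultimately have "4 * (1 - c) * (t^2 + p * t + q - c * (1 + t^2)) \<ge> 0"
    by (simp only:)
  then have "t^2 + p * t + q - c * (1 + t^2) \<ge> 0"
    using c1 by (simp add: zero_le_mult_iff)
  then show ?thesis
    by (simp add: c_def)
qed

lemma quartic_lower_bound:
  assumes "\<And>t. quartic \<alpha> \<beta> \<gamma> t > 0"
  obtains c where "c > 0" "\<And>t. quartic \<alpha> \<beta> \<gamma> t \<ge> c * (1 + t^2)^2"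
proof -
  obtain p q u v where qv: "q * v = 1"
    and cf: "\<alpha> = p + u" "\<beta> = q + v + p * u" "\<gamma> = p * v + q * u"
    and d: "p^2 < 4 * q" "u^2 < 4 * v"
    using positive_factor[OF assms] by metis
  define c1 c2 where "c1 = (4 * q - p^2) / (4 * (1 + q))" and "c2 = (4 * v - u^2) / (4 * (1 + v))"
  have "q > 0" "v > 0"
    using d zero_le_power2[of p] zero_le_power2[of u] by linarith+
  with d have c: "c1 > 0" "c2 > 0"
    by (simp_all add: c1_def c2_def)
  show ?thesis
  proof (rule that[of "c1 * c2"])
    show "quartic \<alpha> \<beta> \<gamma> t \<ge> c1 * c2 * (1 + t^2)^2" for t
    proof -
      have le: "c1 * (1 + t^2) \<le> t^2 + p * t + q" "c2 * (1 + t^2) \<le> t^2 + u * t + v"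
        unfolding c1_def c2_def using d quadratic_lower_bound by blast+
      have nn: "0 \<le> c1 * (1 + t^2)" "0 \<le> c2 * (1 + t^2)"
        using c by simp_all
      have "c1 * c2 * (1 + t^2)^2 = (c1 * (1 + t^2)) * (c2 * (1 + t^2))"
        by (simp add: power2_eq_square)
      also have "\<dots> \<le> (t^2 + p * t + q) * (t^2 + u * t + v)"
        using le nn by (intro mult_mono) auto
      finally show ?thesis
        by (simp add: cf quartic_product qv)
    qed
  qed (use c in simp)
qed

text \<open>These control the change of the quartic when its three free coefficients are
  perturbed.\<close>

lemma monomial_bounds:
  fixes t :: real
  shows "\<bar>t^3\<bar> \<le> (1 + t^2)^2" "\<bar>t^2\<bar> \<le> (1 + t^2)^2" "\<bar>t\<bar> \<le> (1 + t^2)^2"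
proof -
  have t: "\<bar>t\<bar> \<le> 1 + t^2"
    using zero_le_power2[of "\<bar>t\<bar> - 1"] by (simp add: power2_eq_square algebra_simps)
  have sq: "1 + t^2 \<le> (1 + t^2)^2"
    by (rule self_le_power) auto
  have "\<bar>t^3\<bar> = \<bar>t\<bar> * t^2"
    by (simp add: power3_eq_cube power2_eq_square abs_mult)
  also have "\<dots> \<le> (1 + t^2) * (1 + t^2)"
    using t by (intro mult_mono) auto
  finally show "\<bar>t^3\<bar> \<le> (1 + t^2)^2"
    by (simp add: power2_eq_square)
  show "\<bar>t^2\<bar> \<le> (1 + t^2)^2" "\<bar>t\<bar> \<le> (1 + t^2)^2"
    using t sq by (simp_all add: order_trans[OF _ sq])
qed

lemma open_S: "open S"
  unfolding open_dist
proof
  fix x assume "x \<in> S"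
  obtain \<alpha> \<beta> \<gamma> where x: "x = (\<alpha>, \<beta>, \<gamma>)"
    by (cases x)
  with \<open>x \<in> S\<close> have "\<And>t. quartic \<alpha> \<beta> \<gamma> t > 0"
    by (simp add: S_def)
  then obtain c where c: "c > 0" "\<And>t. quartic \<alpha> \<beta> \<gamma> t \<ge> c * (1 + t^2)^2"
    using quartic_lower_bound by metis
  show "\<exists>e>0. \<forall>y. dist y x < e \<longrightarrow> y \<in> S"
  \<comment> \<open>Three coefficients move, and each may use up a third of the lower bound
    \<open>c * (1 + t^2)^2\<close>.\<close>
  proof (intro exI[of _ "c / 3"] conjI allI impI)
    fix y assume y: "dist y x < c / 3"
    obtain a b g where yabg: "y = (a, b, g)"
      by (cases y)
    have coeffs: "\<bar>a - \<alpha>\<bar> < c / 3" "\<bar>b - \<beta>\<bar> < c / 3" "\<bar>g - \<gamma>\<bar> < c / 3"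
      using y dist_fst_le[of y x] dist_snd_le[of y x]
        dist_fst_le[of "snd y" "snd x"] dist_snd_le[of "snd y" "snd x"]
      by (auto simp: x yabg dist_real_def)
    have "quartic a b g t > 0" for t
    proof -
      define w where "w = (1 + t^2)^2"
      have w: "w > 0"
        unfolding w_def by (intro zero_less_power add_pos_nonneg) simp_all
      have bound: "\<bar>d * s\<bar> < c / 3 * w" if "\<bar>d\<bar> < c / 3" "\<bar>s\<bar> \<le> w" for d s
      proof -
        have "\<bar>d * s\<bar> \<le> \<bar>d\<bar> * w"
          using that by (simp add: abs_mult mult_left_mono)
        also have "\<dots> < c / 3 * w"
          using that w by simp
        finally show ?thesis .
      qed
      have "quartic a b g t
          = quartic \<alpha> \<beta> \<gamma> t + (a - \<alpha>) * t^3 + (b - \<beta>) * t^2 + (g - \<gamma>) * t"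
        by (simp add: quartic_def algebra_simps)
      moreover have "\<bar>(a - \<alpha>) * t^3\<bar> < c / 3 * w" "\<bar>(b - \<beta>) * t^2\<bar> < c / 3 * w"
        "\<bar>(g - \<gamma>) * t\<bar> < c / 3 * w"
        by (intro bound coeffs monomial_bounds[of t, folded w_def])+
      moreover have "quartic \<alpha> \<beta> \<gamma> t \<ge> c * w"
        using c by (simp add: w_def)
      ultimately show ?thesis
        by argo
    qed
    then show "y \<in> S"
      by (simp add: S_def yabg)
  qed (use c in simp)
qed

lemma quartic_nonzero_on_interior:
  assumes "(\<alpha>, \<beta>, \<gamma>) \<in> interior Sbar"
  shows "quartic \<alpha> \<beta> \<gamma> t \<noteq> 0"
proof
  assume t: "quartic \<alpha> \<beta> \<gamma> t = 0"
  obtain e where e: "e > 0" "ball (\<alpha>, \<beta>, \<gamma>) e \<subseteq> Sbar"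
    using assms by (auto simp: mem_interior)
  \<comment> \<open>Lowering \<beta> by \<open>e / 2\<close> stays inside the ball but lowers the
    value at the zero \<open>t\<close> by \<open>e / 2 * t^2\<close>.\<close>
  have "(\<alpha>, \<beta> - e / 2, \<gamma>) \<in> ball (\<alpha>, \<beta>, \<gamma>) e"
    using e by (simp add: dist_Pair_Pair dist_real_def)
  with e have "quartic \<alpha> (\<beta> - e / 2) \<gamma> t \<ge> 0"
    by (auto simp: Sbar_def)
  moreover have "quartic \<alpha> (\<beta> - e / 2) \<gamma> t = quartic \<alpha> \<beta> \<gamma> t - e / 2 * t^2"
    by (simp add: quartic_def algebra_simps)
  moreover have "t \<noteq> 0"
    using t by auto
  ultimately show False
    using t e by (simp add: mult_le_0_iff)
qed

lemma S_eq_interior: "S = interior Sbar"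
proof
  show "S \<subseteq> interior Sbar"
    by (intro interior_maximal open_S) (auto simp: S_def Sbar_def intro: less_imp_le)
  show "interior Sbar \<subseteq> S"
  proof
    fix x assume x: "x \<in> interior Sbar"
    obtain \<alpha> \<beta> \<gamma> where xc: "x = (\<alpha>, \<beta>, \<gamma>)"
      by (cases x)
    have "\<forall>t. quartic \<alpha> \<beta> \<gamma> t \<ge> 0"
      using x interior_subset[of Sbar] by (auto simp: xc Sbar_def)
    then have "\<forall>t. quartic \<alpha> \<beta> \<gamma> t > 0"
      using quartic_nonzero_on_interior x by (metis xc order_le_less)
    then show "x \<in> S"
      by (simp add: xc S_def)
  qed
qed

subsection \<open>Convexity, apex and symmetry\<close>

text \<open>For fixed \<open>t\<close> the value of the quartic is affine in the coefficients, so
  each \<open>t\<close> contributes one closed halfspace; closedness and convexity then pass to the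
  intersection.\<close>

lemma Sbar_eq_halfspaces: "Sbar = (\<Inter>t. {x. (t^3, t^2, t) \<bullet> x \<ge> - (t^4 + 1)})"
  by (auto simp: Sbar_def quartic_def algebra_simps) (smt (verit))+

lemma closed_Sbar: "closed Sbar"
  unfolding Sbar_eq_halfspaces by (intro closed_INT ballI closed_halfspace_ge)

lemma convex_Sbar: "convex Sbar"
  unfolding Sbar_eq_halfspaces by (intro convex_INT convex_halfspace_ge)

lemma recession_Sbar: "recession_direction Sbar (0, 1, 0)"
  unfolding recession_direction_def
proof (intro ballI allI impI)
  fix x :: "real \<times> real \<times> real" and \<delta> :: real
  assume "x \<in> Sbar" "\<delta> > 0"
  moreover have "quartic \<alpha> (\<beta> + \<delta>) \<gamma> t = quartic \<alpha> \<beta> \<gamma> t + \<delta> * t^2" for \<alpha> \<beta> \<gamma> t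
    by (simp add: quartic_def algebra_simps)
  ultimately show "x + \<delta> *\<^sub>R (0, 1, 0) \<in> Sbar"
    by (cases x) (auto simp: Sbar_def)
qed

text \<open>Evaluating at \<open>\<plusminus>1\<close> gives \<open>\<beta> \<ge> -2\<close>; in case of equality \<open>1\<close> is a double root.\<close>
lemma apex_Sbar: "apex Sbar (0, 1, 0) (0, -2, 0)"
  unfolding apex_def
proof (intro conjI ballI impI)
  have "quartic 0 (-2) 0 t = (t^2 - 1)^2" for t
    unfolding quartic_def by algebra
  then show "(0, -2, 0) \<in> Sbar"
    by (simp add: Sbar_def)
next
  fix x assume xS: "x \<in> Sbar" and ne: "x \<noteq> (0, -2, 0)"
  obtain \<alpha> \<beta> \<gamma> where x: "x = (\<alpha>, \<beta>, \<gamma>)"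
    by (cases x)
  have nn: "quartic \<alpha> \<beta> \<gamma> t \<ge> 0" for t
    using xS by (simp add: x Sbar_def)
  have sum: "2 + \<alpha> + \<beta> + \<gamma> \<ge> 0" "2 - \<alpha> + \<beta> - \<gamma> \<ge> 0"
    using nn[of 1] nn[of "-1"] by (simp_all add: quartic_def)
  have "\<beta> \<noteq> -2"
  proof
    assume b: "\<beta> = -2"
    with sum have g: "\<gamma> = - \<alpha>"
      by linarith
    have "quartic \<alpha> \<beta> \<gamma> 1 = 0"
      by (simp add: quartic_def b g)
    \<comment> \<open>With \<beta> = -2 these equations give \<open>v = 1\<close> and
      \<open>u = 2\<close>, hence \<alpha> = 0 and \<gamma> = 0.\<close>
    then obtain u v where "1^2 * v = 1" "\<alpha> = - 2 * 1 + u" "\<beta> = 1^2 + v + (- 2 * 1) * u"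
      using double_root_factor[of \<alpha> \<beta> \<gamma> 1] nn by metis
    with b g ne show False
      by (simp add: x)
  qed
  with sum show "(0 :: real, -2 :: real, 0 :: real) \<bullet> (0, 1, 0) < x \<bullet> (0, 1, 0)"
    by (simp add: x)
qed

lemma Sbar_reflect:
  assumes "(\<alpha>, \<beta>, \<gamma>) \<in> Sbar"
  shows "(-\<alpha>, \<beta>, -\<gamma>) \<in> Sbar"
proof -
  have "quartic (-\<alpha>) \<beta> (-\<gamma>) t = quartic \<alpha> \<beta> \<gamma> (-t)" for t
    by (simp add: quartic_def)
  with assms show ?thesis
    by (simp add: Sbar_def)
qed

text \<open>Swapping \<alpha> and \<gamma> reverses the coefficients, that is, turns f(t) into t^4
  f(1/t) for nonzero t.\<close>

lemma Sbar_swap: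
  assumes "(\<alpha>, \<beta>, \<gamma>) \<in> Sbar"
  shows "(\<gamma>, \<beta>, \<alpha>) \<in> Sbar"
proof -
  have "quartic \<gamma> \<beta> \<alpha> t \<ge> 0" for t
  proof (cases "t = 0")
    case False
    then have "quartic \<gamma> \<beta> \<alpha> t = t^4 * quartic \<alpha> \<beta> \<gamma> (1 / t)"
      by (simp add: quartic_def field_simps power4_eq_xxxx power3_eq_cube power2_eq_square)
    with assms show ?thesis
      by (simp add: Sbar_def)
  qed simp
  then show ?thesis
    by (simp add: Sbar_def)
qed

text \<open>As \<open>Sbar\<close> is closed with interior \<open>S\<close>, a boundary point is a
  nonnegative quartic that is not strictly positive, so it has a real zero.\<close>

lemma Disc_frontier:
  assumes "(\<alpha>, \<beta>, \<gamma>) \<in> frontier Sbar"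
  shows "Disc \<alpha> \<beta> \<gamma> = 0"
proof -
  have "(\<alpha>, \<beta>, \<gamma>) \<in> Sbar" "(\<alpha>, \<beta>, \<gamma>) \<notin> S"
    using assms closed_Sbar by (auto simp: frontier_def S_eq_interior)
  then obtain r where "\<And>t. quartic \<alpha> \<beta> \<gamma> t \<ge> 0" "quartic \<alpha> \<beta> \<gamma> r = 0"
    by (auto simp: Sbar_def S_def) (metis not_le order_antisym)
  then show ?thesis
    using Disc_eq_0_if_root by blast
qed

theorem theorem4p4:
  shows "(closed Sbar \<and> convex Sbar \<and> recession_direction Sbar (0, 1, 0)
          \<and> apex Sbar (0, 1, 0) (0, -2, 0))
    \<and> (\<forall>\<alpha> \<beta> \<gamma>. (\<alpha>, \<beta>, \<gamma>) \<in> Sbar \<longrightarrow> (\<gamma>, \<beta>, \<alpha>) \<in> Sbar \<and> (-\<alpha>, \<beta>, -\<gamma>) \<in> Sbar)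
    \<and> (\<forall>\<alpha> \<beta> \<gamma>. (\<alpha>, \<beta>, \<gamma>) \<in> interior Sbar \<longrightarrow>
          (if 2 \<le> \<beta> \<and> \<beta> < 6 \<and> \<alpha> = \<gamma> \<and> \<alpha>^2 + 8 = 4 * \<beta>
           then Disc \<alpha> \<beta> \<gamma> = 0 else Disc \<alpha> \<beta> \<gamma> > 0))
    \<and> (\<forall>\<alpha> \<beta> \<gamma>. (\<alpha>, \<beta>, \<gamma>) \<in> frontier Sbar \<longrightarrow> Disc \<alpha> \<beta> \<gamma> = 0)
    \<and> S = interior Sbar"
proof (intro conjI allI impI)
  fix \<alpha> \<beta> \<gamma>
  assume "(\<alpha>, \<beta>, \<gamma>) \<in> interior Sbar"
  then have "\<And>t. quartic \<alpha> \<beta> \<gamma> t > 0"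
    by (simp add: S_def flip: S_eq_interior)
  then show "if 2 \<le> \<beta> \<and> \<beta> < 6 \<and> \<alpha> = \<gamma> \<and> \<alpha>^2 + 8 = 4 * \<beta>
             then Disc \<alpha> \<beta> \<gamma> = 0 else Disc \<alpha> \<beta> \<gamma> > 0"
    using Disc_pos[of \<alpha> \<beta> \<gamma>] Disc_square[of \<alpha> \<beta>] by auto
qed (use closed_Sbar convex_Sbar recession_Sbar apex_Sbar Sbar_swap Sbar_reflect Disc_frontier
      S_eq_interior in auto)

end
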